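(* Let $\mathcal{P}$ be a finite index set, $\{A_p : p\in\mathcal{P}\}$ a collection of real $n\times n$ matrices, each either stable or unstable, and $\mathcal{R}=\{R_{(p,q)} : p,q\in\mathcal{P}\}$ a collection of nonzero real $n\times n$ matrices. Let $\mathcal{G}$ be a directed graph on the subsystems. For each $p\in\mathcal{P}$ fix a complex Jordan decomposition $A_p=P_pJ_pP_p^{-1}$ and constants $c_p>0$ and $\lambda_p^*>0$ (if $p\in\mathfrak{s}$) or $\mu_p^*>0$ (if $p\in\mathfrak{u}$) such that, for all $t>0$, $\|e^{J_pt}\|\le c_pe^{-\lambda_p^*t}$ if $p\in\mathfrak{s}$ and $\|e^{J_pt}\|\le c_pe^{\mu_p^*t}$ if $p\in\mathfrak{u}$. Set $$\tau_p=\max_{q:(p,q)\in\mathcal{E}(\mathcal{G})}\frac{\ln\left(c_p\,\|P_q^{-1}R_{(p,q)}P_p\|\right)}{\lambda_p^*}\ (p\in\mathfrak{s}),\qquad \eta_p=-\max_{q:(p,q)\in\mathcal{E}(\mathcal{G})}\frac{\ln\left(c_p\,\|P_q^{-1}R_{(p,q)}P_p\|\right)}{\mu_p^*}\ (p\in\mathfrak{u}).$$ Then the reset switched system $\dot x(t)=A_{\sigma(t)}x(t)$, $x(t_k)=R_{(\sigma(t_{k-1}),\sigma(t_k))}\,x(t_k^-)$ ($k\ge1$) is stable for all $\sigma\in\mathcal{S}^{\mathcal{G}}\cap\mathcal{S}^{M}\left(\{\tau_p\}_{p\in\mathfrak{s}},\{\eta_p\}_{p\in\mathfrak{u}}\r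ight)$.
   Context: A real matrix is called stable if all its eigenvalues have negative real part, and unstable if at least one eigenvalue has positive real part; $\mathfrak{s},\mathfrak{u}\subseteq\mathcal{P}$ are the sets of indices $p$ with $A_p$ stable, resp. unstable. $\|\cdot\|$ is the Euclidean norm for vectors and the spectral norm for matrices. A switching signal is a right-continuous piecewise constant function $\sigma:[0,\infty)\to\mathcal{P}$ whose set of discontinuities $\{t_k\}_{k\ge1}$ (switching times) is an increasing sequence with $t_k\uparrow\infty$; put $t_0=0$. $\mathcal{G}$ is a directed graph with vertices the subsystems $A_p$, identified with $p\in\mathcal{P}$, such that every $p$ has at least one outgoing edge $(p,q)\in\mathcal{E}(\mathcal{G})$. $\mathcal{S}^{\mathcal{G}}$ is the set of $\mathcal{G}$-admissible switching signals, i.e. those with $(\sigma(t_{k-1}),\sigma(t_k))\in\mathcal{E}(\mathcal{G})$ for all $k\ge1$. $\mathcal{S}^{M}(\{\tau_p\}_{p\in\mathfrak{s}},\{\eta_p\}_{p\in\mathfrak{u}})$ is the set of switching signals such that for all $k\ge0$: $t_{k+1}-t_k\ge\tau_{\sigma(t_k)}$ if $\sigma(t_k)\in\mathfrak{s}$, and $t_{k+1}-t_k\le\eta_{\sigma(t_k)}$ if $\sigma(t_k)\in\mathfrak{u}$. In the reset switched system, $\dot x=A_{\sigma(t)}x$ holds on each $[t_{k-1},t_k)$ and $x(t_k^-)=\lim_{t\to t_k^-}x(t)$. The system (for fixed $\sigma$) is stable if for every $\epsilon>0$ there is $\delta>0$ such that $\|x(0)\|<\delta$ implies $\|x(t)\|<\epsilon$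 for all $t>0$. *)

theory Defs
  imports "HOL-Analysis.Analysis" "Jordan_Normal_Form.Jordan_Normal_Form"
begin

(* Both libraries use the infix $; keep it for the Cartesian type 'a ^ 'n. *)
no_notation Matrix.vec_index (infixl "$" 100)

section \<open>Matrices\<close>

abbreviation cmat :: "real^'n^'m \<Rightarrow> complex^'n^'m"
  where "cmat \<equiv> map_matrix complex_of_real"

(* Operator norm induced by the Euclidean norm. *)
definition spectral_norm :: "complex^'n^'m \<Rightarrow> real"
  where "spectral_norm M = onorm ((*v) M)"

(* The type class operations * and ^ on 'a^'n^'n are componentwise, so the library's exp is not
   the matrix exponential. *)
definition mpow :: "complex^'n^'n \<Rightarrow> nat \<Rightarrow> complex^'n^'n"
  where "mpow M k = (((**) M) ^^ k) (Finite_Cartesian_Product.mat 1)"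

definition mexp :: "complex^'n^'n \<Rightarrow> complex^'n^'n"
  where "mexp M = (\<Sum>k. (1 / fact k) *\<^sub>R mpow M k)"

definition complex_eigenvalue :: "real^'n^'n \<Rightarrow> complex \<Rightarrow> bool"
  where "complex_eigenvalue M z \<longleftrightarrow> (\<exists>v. v \<noteq> 0 \<and> cmat M *v v = z *s v)"

definition stable_matrix :: "real^'n^'n \<Rightarrow> bool"
  where "stable_matrix M \<longleftrightarrow> (\<forall>z. complex_eigenvalue M z \<longrightarrow> Re z < 0)"

definition unstable_matrix :: "real^'n^'n \<Rightarrow> bool"
  where "unstable_matrix M \<longleftrightarrow> (\<exists>z. complex_eigenvalue M z \<and> Re z > 0)"

definition stable_indices :: "('p \<Rightarrow> real^'n^'n) \<Rightarrow> 'p set"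
  where "stable_indices A = {p. stable_matrix (A p)}"

definition unstable_indices :: "('p \<Rightarrow> real^'n^'n) \<Rightarrow> 'p set"
  where "unstable_indices A = {p. unstable_matrix (A p)}"

(* The index type 'n carries no order, so being a Jordan matrix is relative to an enumeration
   e 0, ..., e (n - 1) of 'n. *)
definition jordan_form :: "(nat \<Rightarrow> 'n::finite) \<Rightarrow> complex^'n^'n \<Rightarrow> bool"
  where "jordan_form e J \<longleftrightarrow>
    (\<exists>blocks. 0 \<notin> fst ` set blocks \<and>
      Matrix.mat CARD('n) CARD('n) (\<lambda>(i, j). J $ e i $ e j) = jordan_matrix blocks)"

definition jordan_decomposition ::
  "(nat \<Rightarrow> 'n::finite) \<Rightarrow> real^'n^'n \<Rightarrow> complex^'n^'n \<Rightarrow> complex^'n^'n \<Rightarrow> bool"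
  where "jordan_decomposition e M Q J \<longleftrightarrow>
    invertible Q \<and> jordan_form e J \<and> cmat M = Q ** J ** matrix_inv Q"


section \<open>Switching signals\<close>

(* Signals live on [0, \<infinity>) and take values in a discrete set, so continuity at s means being
   eventually equal to the value at s. Values at negative times are irrelevant. *)
definition discontinuities :: "(real \<Rightarrow> 'p) \<Rightarrow> real set"
  where "discontinuities \<sigma> = {s. s \<ge> 0 \<and> \<not> (\<forall>\<^sub>F r in at s within {0..}. \<sigma> r = \<sigma> s)}"

definition is_switching_sequence :: "(real \<Rightarrow> 'p) \<Rightarrow> (nat \<Rightarrow> real) \<Rightarrow> bool"
  where "is_switching_sequence \<sigma> t \<longleftrightarrow>
    t 0 = 0 \<and> strict_mono t \<and> filterlim t at_top sequentially \<and>
    discontinuities \<sigma> = t ` {1..} \<and>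
    (\<forall>s\<ge>0. \<forall>\<^sub>F r in at_right s. \<sigma> r = \<sigma> s) \<and>
    (\<forall>k. \<sigma> constant_on {t k<..<t (Suc k)})"

definition switching_signals :: "(real \<Rightarrow> 'p) set"
  where "switching_signals = {\<sigma>. \<exists>t. is_switching_sequence \<sigma> t}"

definition switching_time :: "(real \<Rightarrow> 'p) \<Rightarrow> nat \<Rightarrow> real"
  where "switching_time \<sigma> = (THE t. is_switching_sequence \<sigma> t)"

lemma strict_mono_range_unique:
  fixes f g :: "nat \<Rightarrow> real"
  assumes f: "strict_mono f" and g: "strict_mono g" and eq: "range f = range g"
  shows "f = g"
proof
  fix n
  show "f n = g n"
  proof (induction n rule: less_induct)
    case (less n)
    have le: "a n \<le> b n"
      if a: "strict_mono a" and b: "strict_mono b" and r: "range a = range b"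
        and IH: "\<And>m. m < n \<Longrightarrow> a m = b m" for a b :: "nat \<Rightarrow> real"
    proof -
      obtain m where m: "b n = a m"
        using r by (metis rangeE rangeI)
      have "\<not> m < n"
        using IH[of m] m b by (metis less_irrefl strict_mono_less)
      then show ?thesis
        using m a by (simp add: strict_mono_less_eq)
    qed
    show ?case
      using le[OF f g eq] le[OF g f eq[symmetric]] less by (metis order_antisym)
  qed
qed

lemma switching_time_eq:
  assumes t: "is_switching_sequence \<sigma> t"
  shows "switching_time \<sigma> = t"
  unfolding switching_time_def
proof (rule the_equality[where P = "is_switching_sequence \<sigma>", OF t])
  fix u assume u: "is_switching_sequence \<sigma> u"
  have shift: "v ` {1..} = range (\<lambda>k. v (Suc k))" for v :: "nat \<Rightarrow> real"
  proof -
    have "{1..} = range Suc"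
      by (auto simp: image_iff Suc_le_eq gr0_conv_Suc)
    then show ?thesis by (simp add: image_image)
  qed
  have "range (\<lambda>k. u (Suc k)) = range (\<lambda>k. t (Suc k))"
    using t u by (metis is_switching_sequence_def shift)
  moreover have "strict_mono (\<lambda>k. u (Suc k))" "strict_mono (\<lambda>k. t (Suc k))"
    using t u by (simp_all add: is_switching_sequence_def strict_mono_Suc_iff)
  ultimately have "(\<lambda>k. u (Suc k)) = (\<lambda>k. t (Suc k))"
    by (intro strict_mono_range_unique)
  then have "u k = t k" for k
    using t u by (cases k) (auto simp: is_switching_sequence_def dest: fun_cong)
  then show "u = t" by blast
qed

definition admissible_signals :: "('p \<times> 'p) set \<Rightarrow> (real \<Rightarrow> 'p) set"
  where "admissible_signals E = {\<sigma> \<in> switching_signals. \<forall>k\<ge>1.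
    (\<sigma> (switching_time \<sigma> (k - 1)), \<sigma> (switching_time \<sigma> k)) \<in> E}"

definition mode_dependent_signals ::
  "('p \<Rightarrow> real^'n^'n) \<Rightarrow> ('p \<Rightarrow> real) \<Rightarrow> ('p \<Rightarrow> real) \<Rightarrow> (real \<Rightarrow> 'p) set"
  where "mode_dependent_signals A \<tau> \<eta> = {\<sigma> \<in> switching_signals. \<forall>k.
    (\<sigma> (switching_time \<sigma> k) \<in> stable_indices A \<longrightarrow>
      switching_time \<sigma> (k + 1) - switching_time \<sigma> k \<ge> \<tau> (\<sigma> (switching_time \<sigma> k))) \<and>
    (\<sigma> (switching_time \<sigma> k) \<in> unstable_indices A \<longrightarrow>
      switching_time \<sigma> (k + 1) - switching_time \<sigma> k \<le> \<eta> (\<sigma> (switching_time \<sigma> k)))}"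


section \<open>Reset switched systems\<close>

definition reset_solution ::
  "('p \<Rightarrow> real^'n^'n) \<Rightarrow> ('p \<times> 'p \<Rightarrow> real^'n^'n) \<Rightarrow> (real \<Rightarrow> 'p) \<Rightarrow> (real \<Rightarrow> real^'n) \<Rightarrow> bool"
  where "reset_solution A R \<sigma> x \<longleftrightarrow> (\<forall>k\<ge>1.
    (\<forall>s\<in>{switching_time \<sigma> (k - 1)..<switching_time \<sigma> k}.
      (x has_vector_derivative (A (\<sigma> s) *v x s))
        (at s within {switching_time \<sigma> (k - 1)..<switching_time \<sigma> k})) \<and>
    (\<exists>l. (x \<longlongrightarrow> l) (at_left (switching_time \<sigma> k)) \<and>
      x (switching_time \<sigma> k) =
        R (\<sigma> (switching_time \<sigma> (k - 1)), \<sigma> (switching_time \<sigma> k)) *v l))"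

definition reset_system_stable ::
  "('p \<Rightarrow> real^'n^'n) \<Rightarrow> ('p \<times> 'p \<Rightarrow> real^'n^'n) \<Rightarrow> (real \<Rightarrow> 'p) \<Rightarrow> bool"
  where "reset_system_stable A R \<sigma> \<longleftrightarrow>
    (\<forall>\<epsilon>>0. \<exists>\<delta>>0. \<forall>x. reset_solution A R \<sigma> x \<longrightarrow> norm (x 0) < \<delta> \<longrightarrow> (\<forall>t>0. norm (x t) < \<epsilon>))"

end

theory Submission
  imports Defs
begin

text \<open>
  In mode \<open>p\<close> measure the state by \<open>V = \<parallel>P\<^sub>p\<^sup>-\<^sup>1 x\<parallel>\<close>. Along the flow \<open>P\<^sub>p\<^sup>-\<^sup>1 x\<close> solves \<open>z' = J\<^sub>p z\<close>,
  so \<open>V\<close> grows by at most \<open>c\<^sub>p exp (r\<^sub>p t)\<close>, where \<open>r\<^sub>p\<close> is \<open>- lam p\<close> or \<open>mu p\<close>; a reset to mode \<open>q\<close>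
  multiplies it by at most \<open>\<parallel>P\<^sub>q\<^sup>-\<^sup>1 R P\<^sub>p\<parallel>\<close>. The dwell and flee times are exactly what makes the
  product of both factors at most 1, so \<open>V\<close> does not increase from one switching time to the next.
  Between switching times \<open>V\<close> is bounded by a constant multiple of its last switching value because
  there are finitely many modes.
\<close>

section \<open>Matrices\<close>

text \<open>Bilinearity suffices, since bilinear maps on finite-dimensional spaces are bounded. This
  provides the product rule for differentiating
  \<open>mexp ((t - s) *\<^sub>R M) *v z s\<close>.\<close>

lemma bounded_bilinear_matrix_vector_mult:
  "bounded_bilinear ((*v) :: complex^'n^'m \<Rightarrow> complex^'n \<Rightarrow> complex^'m)"
  unfolding bilinear_conv_bounded_bilinear[symmetric] bilinear_def
  by (auto intro!: linearI simp: Finite_Cartesian_Product.vec_eq_iff matrix_vector_mult_def sum.distrib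
      algebra_simps scaleR_sum_right)

lemma bounded_bilinear_matrix_matrix_mult:
  "bounded_bilinear ((**) :: complex^'n^'m \<Rightarrow> complex^'k^'n \<Rightarrow> complex^'k^'m)"
  unfolding bilinear_conv_bounded_bilinear[symmetric] bilinear_def
  by (auto intro!: linearI simp: Finite_Cartesian_Product.vec_eq_iff matrix_matrix_mult_def sum.distrib
      algebra_simps scaleR_sum_right)

lemma norm_matrix_vector_le: "norm (M *v v) \<le> spectral_norm M * norm v"
  unfolding spectral_norm_def by (rule onorm) simp

lemma spectral_norm_nonneg: "spectral_norm M \<ge> 0"
  unfolding spectral_norm_def by (rule onorm_pos_le) simp

lemma spectral_norm_pos:
  assumes "M \<noteq> 0"
  shows "spectral_norm M > 0"
proof -
  have "\<not> (\<forall>v. M *v v = 0)"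
    using assms matrix_eq[of M 0] by auto
  then show ?thesis
    unfolding spectral_norm_def by (subst onorm_pos_lt) auto
qed

section \<open>The matrix exponential\<close>

lemma mpow_0 [simp]: "mpow M 0 = Finite_Cartesian_Product.mat 1"
  by (simp add: mpow_def)

lemma mpow_Suc: "mpow M (Suc k) = M ** mpow M k"
  by (simp add: mpow_def)

lemma mpow_Suc_right: "mpow M (Suc k) = mpow M k ** M"
  by (induction k) (simp_all add: mpow_Suc matrix_mul_assoc)

lemma mpow_scaleR: "mpow (s *\<^sub>R M) k = s ^ k *\<^sub>R mpow M k"
  by (induction k)
    (simp_all add: mpow_Suc bounded_bilinear.scaleR_left[OF bounded_bilinear_matrix_matrix_mult]
      bounded_bilinear.scaleR_right[OF bounded_bilinear_matrix_matrix_mult])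

text \<open>Boundedness of the product makes the norm submultiplicative up to a factor
  \<open>K\<close>, so the powers grow at most like \<open>(norm M * K) ^ k\<close> and the scalar
  exponential series dominates.\<close>

lemma summable_mexp:
  fixes M :: "complex^'n^'n"
  shows "summable (\<lambda>k. (1 / fact k) *\<^sub>R mpow M k)"
proof -
  obtain K where K: "K > 0"
    "\<And>(X :: complex^'n^'n) (Y :: complex^'n^'n). norm (X ** Y) \<le> norm X * norm Y * K"
    using bounded_bilinear.pos_bounded[OF bounded_bilinear_matrix_matrix_mult] by metis
  let ?C = "norm (Finite_Cartesian_Product.mat 1 :: complex^'n^'n)"
  have bound: "norm (mpow M k) \<le> ?C * (norm M * K) ^ k" for k
  proof (induction k)
    case (Suc k)
    have "norm (mpow M (Suc k)) \<le> norm M * norm (mpow M k) * K"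
      using K(2)[of M "mpow M k"] by (simp add: mpow_Suc)
    also have "\<dots> \<le> norm M * (?C * (norm M * K) ^ k) * K"
      using Suc K(1) by (intro mult_right_mono mult_left_mono) auto
    finally show ?case by (simp add: mult_ac)
  qed simp
  show ?thesis
  proof (rule summable_comparison_test')
    show "summable (\<lambda>k. ?C * (inverse (fact k) * (norm M * K) ^ k))"
      by (intro summable_mult summable_exp)
    show "norm ((1 / fact k) *\<^sub>R mpow M k) \<le> ?C * (inverse (fact k) * (norm M * K) ^ k)"
      if "k \<ge> 0" for k
      using mult_right_mono[OF bound[of k], of "inverse (fact k)"]
      by (simp add: field_simps)
  qed
qed

text \<open>Each entry of the exponential along the ray through \<open>M\<close> is a power series
  in \<open>s\<close>, so scalar power series theory gives its value at 0 and its
  derivative.\<close>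

lemma mexp_nth_sums:
  "(\<lambda>k. mpow M k $ i $ j / fact k * of_real s ^ k) sums (mexp (s *\<^sub>R M) $ i $ j)"
proof -
  have "(\<lambda>k. (1 / fact k) *\<^sub>R mpow (s *\<^sub>R M) k) sums mexp (s *\<^sub>R M)"
    unfolding mexp_def by (intro summable_sums summable_mexp)
  then have "(\<lambda>k. ((1 / fact k) *\<^sub>R mpow (s *\<^sub>R M) k) $ i $ j) sums (mexp (s *\<^sub>R M) $ i $ j)"
    by (intro sums_vec_nth)
  then show ?thesis
    by (simp add: mpow_scaleR scaleR_conv_of_real[where 'a = complex] mult_ac divide_inverse)
qed

lemma mexp_0 [simp]: "mexp 0 = (Finite_Cartesian_Product.mat 1 :: complex^'n^'n)"
proof -
  have "mexp (0 *\<^sub>R M) $ i $ j = (Finite_Cartesian_Product.mat 1 :: complex^'n^'n) $ i $ j"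
    for M :: "complex^'n^'n" and i j
    by (rule sums_unique2[OF mexp_nth_sums[of M i j 0]])
      (use powser_sums_zero[of "\<lambda>k. mpow M k $ i $ j / fact k"] in simp)
  from this[of 0] show ?thesis by (simp add: Finite_Cartesian_Product.vec_eq_iff)
qed

lemma has_vector_derivative_vec:
  fixes f :: "real \<Rightarrow> 'a::real_normed_vector ^ 'n"
  assumes "\<And>i. ((\<lambda>s. f s $ i) has_vector_derivative f' $ i) (at s within S)"
  shows "(f has_vector_derivative f') (at s within S)"
  unfolding has_vector_derivative_def has_derivative_within
proof (intro conjI vec_tendstoI)
  fix i
  show "((\<lambda>y. ((1 / norm (y - s)) *\<^sub>R (f y - (f s + (y - s) *\<^sub>R f'))) $ i)
      \<longlongrightarrow> 0 $ i) (at s within S)"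
    using assms[of i] unfolding has_vector_derivative_def has_derivative_within by simp
qed (simp add: bounded_linear_scaleR_left)

text \<open>Termwise differentiation of the entry series. The factor \<open>M\<close> stands on the
  right so that it meets the vector when the product with a solution is differentiated.\<close>

lemma has_vector_derivative_mexp:
  "((\<lambda>s. mexp (s *\<^sub>R M)) has_vector_derivative (mexp (s *\<^sub>R M) ** M)) (at s within S)"
proof (intro has_vector_derivative_vec)
  fix i j
  let ?c = "\<lambda>k. mpow M k $ i $ j / fact k"
  have summ: "summable (\<lambda>k. ?c k * y ^ k)" for y :: complex
  proof -
    \<comment> \<open>The entry series is known to converge only at real points; convergence at one
      real point of modulus larger than \<open>norm y\<close> gives it at the complex point
      \<open>y\<close>.\<close>
    have "summable (\<lambda>k. ?c k * of_real (norm y + 1) ^ k)"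
      using mexp_nth_sums[of M i j "norm y + 1"] sums_summable by blast
    then show ?thesis
      by (rule powser_inside) (use norm_of_real[of "norm y + 1", where 'a = complex] in linarith)
  qed
  have "((\<lambda>k. diffs ?c k * of_real s ^ k)) sums (mexp (s *\<^sub>R M) ** M) $ i $ j"
  proof -
    have "(\<lambda>k. \<Sum>l\<in>UNIV. (mpow M k $ i $ l / fact k * of_real s ^ k) * M $ l $ j)
        sums (\<Sum>l\<in>UNIV. mexp (s *\<^sub>R M) $ i $ l * M $ l $ j)"
      by (intro sums_sum sums_mult2 mexp_nth_sums)
    moreover have "(\<Sum>l\<in>UNIV. (mpow M k $ i $ l / fact k * of_real s ^ k) * M $ l $ j)
        = diffs ?c k * of_real s ^ k" for k
    proof -
      \<comment> \<open>The factor \<open>Suc k\<close> from differentiation cancels against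
        \<open>fact (Suc k)\<close>, and splitting off the last factor of the power produces the
        product with \<open>M\<close>.\<close>
      have "diffs ?c k = mpow M (Suc k) $ i $ j / fact k"
        by (simp add: diffs_def field_simps del: of_nat_Suc)
      then show ?thesis
        by (simp add: mpow_Suc_right matrix_matrix_mult_def sum_distrib_left sum_distrib_right
            sum_divide_distrib mult_ac)
    qed
    ultimately show ?thesis by (simp add: matrix_matrix_mult_def)
  qed
  then have "((\<lambda>x. \<Sum>k. ?c k * x ^ k) has_field_derivative (mexp (s *\<^sub>R M) ** M) $ i $ j)
      (at (of_real s))"
    using termdiffs_strong_converges_everywhere[of ?c "of_real s", OF summ] by (simp add: sums_iff)
  then have "((\<lambda>x. \<Sum>k. ?c k * of_real x ^ k) has_vector_derivative
      (mexp (s *\<^sub>R M) ** M) $ i $ j) (at s within S)"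
    by (rule has_vector_derivative_real_field)
  moreover have "(\<Sum>k. ?c k * of_real x ^ k) = mexp (x *\<^sub>R M) $ i $ j" for x
    by (rule sums_unique[OF mexp_nth_sums, symmetric])
  ultimately show "((\<lambda>x. mexp (x *\<^sub>R M) $ i $ j) has_vector_derivative
      (mexp (s *\<^sub>R M) ** M) $ i $ j) (at s within S)" by simp
qed

lemma linear_ode_solution:
  fixes z :: "real \<Rightarrow> complex^'n"
  assumes z: "\<And>s. s \<in> {a..<b} \<Longrightarrow> (z has_vector_derivative (M *v z s)) (at s within {a..<b})"
    and t: "t \<in> {a..<b}"
  shows "z t = mexp ((t - a) *\<^sub>R M) *v z a"
proof -
  \<comment> \<open>Running the flow backwards from \<open>t\<close> makes \<open>y\<close> constant, without inverting the exponential.\<close>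
  define y where "y s = mexp ((t - s) *\<^sub>R M) *v z s" for s
  have "(y has_vector_derivative 0) (at s within {a..<b})" if s: "s \<in> {a..<b}" for s
  proof -
    have "((\<lambda>s. mexp ((t - s) *\<^sub>R M)) has_vector_derivative
        (- 1) *\<^sub>R (mexp ((t - s) *\<^sub>R M) ** M)) (at s within {a..<b})"
      using vector_diff_chain_within[where f = "\<lambda>s. t - s" and f' = "-1",
          OF _ has_vector_derivative_mexp]
      by (force simp: o_def intro!: derivative_eq_intros)
    from bounded_bilinear.has_vector_derivative[OF bounded_bilinear_matrix_vector_mult
        this z[OF s]]
    show ?thesis
      unfolding y_def
      by (simp add: matrix_vector_mul_assoc
          bounded_bilinear.minus_left[OF bounded_bilinear_matrix_vector_mult])
  qed
  then obtain v where v: "\<And>s. s \<in> {a..<b} \<Longrightarrow> y s = v"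
    using has_vector_derivative_zero_constant[of "{a..<b}" y] by auto
  have "y t = y a" using v[OF t] v[of a] t by auto
  then show ?thesis by (simp add: y_def)
qed

section \<open>Complexification\<close>

text \<open>Embeds real states isometrically into the complex space on which \<open>P\<close> and
  \<open>J\<close> act.\<close>

definition cvec :: "real^'n \<Rightarrow> complex^'n"
  where "cvec v = (\<chi> i. complex_of_real (v $ i))"

lemma norm_cvec [simp]: "norm (cvec v) = norm v"
  by (simp add: cvec_def norm_vec_def)

lemma bounded_linear_cvec: "bounded_linear cvec"
proof (rule bounded_linear_intro[where K = 1])
  show "cvec (r *\<^sub>R v) = r *\<^sub>R cvec v" for r and v :: "real^'n"
    by (simp add: cvec_def Finite_Cartesian_Product.vec_eq_iff scaleR_conv_of_real[where 'a = complex])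
  show "norm (cvec v) \<le> norm v * 1" for v :: "real^'n"
    by simp
qed (simp add: cvec_def Finite_Cartesian_Product.vec_eq_iff)

lemma cvec_mult: "cvec (M *v v) = cmat M *v cvec v"
  by (simp add: cvec_def Finite_Cartesian_Product.vec_eq_iff matrix_vector_mult_def)

section \<open>Stability\<close>

lemma switching_signal_constant:
  assumes t: "is_switching_sequence \<sigma> t" and s: "s \<in> {t k..<t (Suc k)}"
  shows "\<sigma> s = \<sigma> (t k)"
proof (cases "s = t k")
  case False
  have tk: "t k \<ge> 0"
    using t by (metis is_switching_sequence_def strict_mono_less_eq zero_le)
  have lt: "t k < t (Suc k)" using s by auto
  obtain c where c: "\<And>r. r \<in> {t k<..<t (Suc k)} \<Longrightarrow> \<sigma> r = c"
    using t unfolding is_switching_sequence_def constant_on_def by meson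
  \<comment> \<open>Constancy is given only on the open interval; right-continuity at
    \<open>t k\<close> identifies the constant \<open>c\<close> with the value at the left
    endpoint.\<close>
  have "\<forall>\<^sub>F r in at_right (t k). \<sigma> r = \<sigma> (t k)"
    using t tk unfolding is_switching_sequence_def by auto
  moreover have "\<forall>\<^sub>F r in at_right (t k). r \<in> {t k<..<t (Suc k)}"
    using eventually_at_right_real[OF lt] .
  ultimately have "\<forall>\<^sub>F r in at_right (t k). c = \<sigma> (t k)"
    by eventually_elim (use c in auto)
  then have "c = \<sigma> (t k)" by simp
  then show ?thesis using c[of s] s False by auto
qed simp

lemma switching_sequence_interval:
  assumes t: "is_switching_sequence \<sigma> t" and s: "s \<ge> 0"
  obtains k where "s \<in> {t k..<t (Suc k)}"
proof -
  have "\<forall>\<^sub>F k in sequentially. s < t k"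
    using t by (auto simp: is_switching_sequence_def filterlim_at_top_dense)
  then obtain m where m: "s < t m" by (auto simp: eventually_sequentially)
  \<comment> \<open>The interval containing \<open>s\<close> starts one index before
    \<open>n\<close>; here \<open>n\<close> is nonzero because
    \<open>t 0 = 0 \<le> s\<close>.\<close>
  define n where "n = (LEAST n. s < t n)"
  have "s < t n" unfolding n_def using m by (rule LeastI)
  moreover have "n \<noteq> 0"
    using calculation s t by (metis is_switching_sequence_def not_less)
  moreover have "\<not> s < t (n - 1)"
    unfolding n_def[symmetric] using not_less_Least[of "n - 1" "\<lambda>n. s < t n"] \<open>n \<noteq> 0\<close>
    by (simp add: n_def[symmetric])
  ultimately show ?thesis using that[of "n - 1"] by auto
qed

section \<open>Transitions and growth in Jordan coordinates\<close>

lemma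
  assumes "invertible Q"
  shows matrix_inv_right: "Q ** matrix_inv Q = Finite_Cartesian_Product.mat 1"
    and matrix_inv_left: "matrix_inv Q ** Q = Finite_Cartesian_Product.mat 1"
  using assms someI_ex[of "\<lambda>Q'. Q ** Q' = Finite_Cartesian_Product.mat 1 \<and> Q' ** Q = Finite_Cartesian_Product.mat 1"]
  unfolding invertible_def matrix_inv_def by auto

text \<open>Multiplying back by the invertible factors recovers \<open>R\<close>. Positivity ensures
  that exponentiating the logarithms in the dwell and flee times gives back their arguments.\<close>

lemma spectral_norm_transition_pos:
  assumes "R \<noteq> 0" "invertible Q" "invertible Q'"
  shows "spectral_norm (matrix_inv Q' ** cmat R ** Q) > 0"
proof (rule spectral_norm_pos, rule notI)
  assume 0: "matrix_inv Q' ** cmat R ** Q = 0"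
  have "cmat R = Q' ** (matrix_inv Q' ** cmat R ** Q) ** matrix_inv Q"
    using assms by (metis matrix_inv_right matrix_mul_assoc matrix_mul_lid matrix_mul_rid)
  then have "cmat R = 0" by (simp add: 0)
  then have "R = 0" by (simp add: Finite_Cartesian_Product.vec_eq_iff)
  then show False using assms by simp
qed

text \<open>The signed rate \<open>r\<close> serves both kinds of mode. The endpoint
  \<open>a\<close> is left out because the bound on the exponential is assumed only for positive
  times.\<close>

lemma mode_norm_le:
  fixes x :: "real \<Rightarrow> real^'n"
  assumes Q: "invertible Q" "cmat M = Q ** J ** matrix_inv Q"
    and x: "\<And>s. s \<in> {a..<b} \<Longrightarrow> (x has_vector_derivative (M *v x s)) (at s within {a..<b})"
    and bound: "\<And>t. t > 0 \<Longrightarrow> spectral_norm (mexp (t *\<^sub>R J)) \<le> c * exp (r * t)"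
    and t: "t \<in> {a<..<b}"
  shows "norm (matrix_inv Q *v cvec (x t))
    \<le> c * exp (r * (t - a)) * norm (matrix_inv Q *v cvec (x a))"
proof -
  define z where "z s = matrix_inv Q *v cvec (x s)" for s
  have "(z has_vector_derivative (J *v z s)) (at s within {a..<b})" if s: "s \<in> {a..<b}" for s
  proof -
    have "bounded_linear (\<lambda>v. matrix_inv Q *v cvec v)"
      by (rule bounded_linear_compose[OF _ bounded_linear_cvec]) simp
    from bounded_linear.has_vector_derivative[OF this x[OF s]]
    have "(z has_vector_derivative matrix_inv Q *v (cmat M *v cvec (x s))) (at s within {a..<b})"
      unfolding z_def[abs_def] cvec_mult .
    moreover have "matrix_inv Q *v (cmat M *v cvec (x s)) = J *v z s"
      unfolding z_def Q(2) matrix_vector_mul_assoc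
      using Q(1) by (metis matrix_inv_left matrix_mul_assoc matrix_mul_lid)
    ultimately show ?thesis by simp
  qed
  then have "z t = mexp ((t - a) *\<^sub>R J) *v z a"
    using t by (intro linear_ode_solution) auto
  then have "norm (z t) \<le> spectral_norm (mexp ((t - a) *\<^sub>R J)) * norm (z a)"
    by (simp add: norm_matrix_vector_le)
  also have "\<dots> \<le> c * exp (r * (t - a)) * norm (z a)"
    using t by (intro mult_right_mono bound) auto
  finally show ?thesis by (simp add: z_def)
qed

text \<open>The flow bound passes to the left limit \<open>l\<close>, to which the reset applies;
  inserting \<open>Q ** matrix_inv Q\<close> before \<open>l\<close> expresses the reset in the new
  coordinates.\<close>

lemma reset_norm_le:
  fixes x :: "real \<Rightarrow> real^'n"
  assumes Q: "invertible Q"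
    and ab: "a < b"
    and x: "\<And>t. t \<in> {a<..<b} \<Longrightarrow> norm (matrix_inv Q *v cvec (x t)) \<le> c * exp (r * (t - a)) * V"
    and l: "(x \<longlongrightarrow> l) (at_left b)"
  shows "norm (matrix_inv Q' *v cvec (R *v l))
    \<le> spectral_norm (matrix_inv Q' ** cmat R ** Q) * (c * exp (r * (b - a)) * V)"
proof -
  have "bounded_linear (\<lambda>v. matrix_inv Q *v cvec v)"
    by (rule bounded_linear_compose[OF _ bounded_linear_cvec]) simp
  then have lim: "((\<lambda>t. norm (matrix_inv Q *v cvec (x t))) \<longlongrightarrow> norm (matrix_inv Q *v cvec l)) (at_left b)"
    by (rule tendsto_norm[OF bounded_linear.tendsto[OF _ l]])
  have "((\<lambda>t. c * exp (r * (t - a)) * V) \<longlongrightarrow> c * exp (r * (b - a)) * V) (at_left b)"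
    by (intro tendsto_intros)
  moreover have "\<forall>\<^sub>F t in at_left b. norm (matrix_inv Q *v cvec (x t)) \<le> c * exp (r * (t - a)) * V"
    using eventually_at_left_real[OF ab] by eventually_elim (rule x)
  ultimately have le: "norm (matrix_inv Q *v cvec l) \<le> c * exp (r * (b - a)) * V"
    using lim by (intro tendsto_le) auto
  have "matrix_inv Q' *v cvec (R *v l)
      = (matrix_inv Q' ** cmat R ** Q) *v (matrix_inv Q *v cvec l)"
    unfolding cvec_mult matrix_vector_mul_assoc
    using Q by (metis matrix_inv_right matrix_mul_assoc matrix_mul_rid)
  then show ?thesis
    using norm_matrix_vector_le[of "matrix_inv Q' ** cmat R ** Q" "matrix_inv Q *v cvec l"]
      mult_left_mono[OF le spectral_norm_nonneg[of "matrix_inv Q' ** cmat R ** Q"]] by simp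
qed

section \<open>Uniform bound on solutions and stability\<close>

theorem theorem6p1:
  fixes A :: "'p::finite \<Rightarrow> real^'n^'n"
    and R :: "'p \<times> 'p \<Rightarrow> real^'n^'n"
    and E :: "('p \<times> 'p) set"
    and e :: "nat \<Rightarrow> 'n"
    and P J :: "'p \<Rightarrow> complex^'n^'n"
    and c lam mu \<tau> \<eta> :: "'p \<Rightarrow> real"
  assumes "\<And>p. stable_matrix (A p) \<or> unstable_matrix (A p)"
    and "\<And>p q. R (p, q) \<noteq> 0"
    and "\<And>p. \<exists>q. (p, q) \<in> E"
    and "bij_betw e {..<CARD('n)} UNIV"
    and "\<And>p. jordan_decomposition e (A p) (P p) (J p)"
    and "\<And>p. c p > 0"
    and "\<And>p. p \<in> stable_indices A \<Longrightarrow> lam p > 0"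
    and "\<And>p. p \<in> unstable_indices A \<Longrightarrow> mu p > 0"
    and "\<And>p t. p \<in> stable_indices A \<Longrightarrow> t > 0 \<Longrightarrow>
           spectral_norm (mexp (t *\<^sub>R J p)) \<le> c p * exp (- lam p * t)"
    and "\<And>p t. p \<in> unstable_indices A \<Longrightarrow> t > 0 \<Longrightarrow>
           spectral_norm (mexp (t *\<^sub>R J p)) \<le> c p * exp (mu p * t)"
    and "\<And>p. p \<in> stable_indices A \<Longrightarrow>
           \<tau> p = (MAX q\<in>{q. (p, q) \<in> E}.
             ln (c p * spectral_norm (matrix_inv (P q) ** cmat (R (p, q)) ** P p)) / lam p)"
    and "\<And>p. p \<in> unstable_indices A \<Longrightarrow>
           \<eta> p = - (MAX q\<in>{q. (p, q) \<in> E}.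
             ln (c p * spectral_norm (matrix_inv (P q) ** cmat (R (p, q)) ** P p)) / mu p)"
  shows "\<forall>\<sigma> \<in> admissible_signals E \<inter> mode_dependent_signals A \<tau> \<eta>. reset_system_stable A R \<sigma>"
proof (intro ballI)
  fix \<sigma> assume \<sigma>: "\<sigma> \<in> admissible_signals E \<inter> mode_dependent_signals A \<tau> \<eta>"
  define t where "t = switching_time \<sigma>"
  have t: "is_switching_sequence \<sigma> t"
    using \<sigma> by (auto simp: admissible_signals_def switching_signals_def t_def switching_time_eq)
  have t0: "t 0 = 0" and t_less: "t k < t (Suc k)" for k
    using t by (auto simp: is_switching_sequence_def strict_mono_Suc_iff)
  define m where "m k = \<sigma> (t k)" for k
  have edge: "(m k, m (Suc k)) \<in> E" for k
    using \<sigma> by (auto simp: admissible_signals_def m_def t_def dest: spec[of _ "Suc k"])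
  have dwell: "\<tau> (m k) \<le> t (Suc k) - t k" if "m k \<in> stable_indices A" for k
    using \<sigma> that by (auto simp: mode_dependent_signals_def m_def t_def)
  have flee: "t (Suc k) - t k \<le> \<eta> (m k)" if "m k \<in> unstable_indices A" for k
    using \<sigma> that by (auto simp: mode_dependent_signals_def m_def t_def)

  have inv: "invertible (P p)" and dec: "cmat (A p) = P p ** J p ** matrix_inv (P p)" for p
    using assms(5)[of p] by (auto simp: jordan_decomposition_def)
  define N where "N p q = spectral_norm (matrix_inv (P q) ** cmat (R (p, q)) ** P p)" for p q
  have N_pos: "N p q > 0" for p q
    unfolding N_def by (intro spectral_norm_transition_pos inv assms(2))
  have c_pos: "c p > 0" for p by (rule assms(6))
  define r where "r p = (if p \<in> stable_indices A then - lam p else mu p)" for p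
  have uns: "p \<in> unstable_indices A" if "p \<notin> stable_indices A" for p
    using assms(1)[of p] that by (simp add: stable_indices_def unstable_indices_def)
  have bound: "spectral_norm (mexp (s *\<^sub>R J p)) \<le> c p * exp (r p * s)" if "s > 0" for p s
    using assms(9,10)[of p s] uns[of p] that by (auto simp: r_def)

  \<comment> \<open>Proved in logarithmic form: admissibility makes the actual transition one of the
    edges in the maximum, and multiplying by the positive rate \<open>lam\<close> or
    \<open>mu\<close> clears the denominator.\<close>
  have gain: "N (m k) (m (Suc k)) * (c (m k) * exp (r (m k) * (t (Suc k) - t k))) \<le> 1" for k
  proof -
    define p q where "p = m k" and "q = m (Suc k)"
    let ?a = "c p * N p q" and ?d = "t (Suc k) - t k"
    have a: "?a > 0" using c_pos N_pos by simp
    have q: "q \<in> {q. (p, q) \<in> E}" using edge by (simp add: p_def q_def)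
    have "ln ?a + r p * ?d \<le> 0"
    proof (cases "p \<in> stable_indices A")
      case True
      have "ln ?a / lam p \<le> \<tau> p"
        unfolding assms(11)[OF True] N_def using q by (intro Max_ge) auto
      also have "\<dots> \<le> ?d" using dwell[of k] True by (simp add: p_def)
      finally show ?thesis
        using assms(7)[OF True] True by (simp add: r_def field_simps)
    next
      case False
      note U = uns[OF False]
      have "ln ?a / mu p \<le> - \<eta> p"
        unfolding assms(12)[OF U] N_def minus_minus using q by (intro Max_ge) auto
      also have "\<dots> \<le> - ?d" using flee[of k] U by (simp add: p_def)
      finally show ?thesis
        using assms(8)[OF U] False by (simp add: r_def field_simps)
    qed
    then have "exp (ln ?a + r p * ?d) \<le> 1" by simp
    then have "?a * exp (r p * ?d) \<le> 1" using a by (simp only: exp_add exp_ln)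
    then show ?thesis by (simp add: p_def q_def mult_ac)
  qed

  \<comment> \<open>In an unstable mode \<open>gain\<close> itself bounds the growth by \<open>1 / N p q\<close>.\<close>
  define C where "C = 1 + (\<Sum>p\<in>UNIV. c p) + (\<Sum>pq\<in>UNIV. 1 / N (fst pq) (snd pq))"
  have C_c: "c p \<le> C" and C_N: "1 / N p q \<le> C" and C_1: "1 \<le> C" for p q
  proof -
    have "c p \<le> (\<Sum>p\<in>UNIV. c p)"
      by (rule member_le_sum) (auto intro: less_imp_le[OF c_pos])
    moreover have "1 / N p q \<le> (\<Sum>pq\<in>UNIV. 1 / N (fst pq) (snd pq))"
      using member_le_sum[of "(p, q)" UNIV "\<lambda>pq. 1 / N (fst pq) (snd pq)"]
      by (simp add: less_imp_le[OF N_pos])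
    ultimately show "c p \<le> C" "1 / N p q \<le> C" "1 \<le> C"
      using c_pos[of p] zero_less_divide_1_iff[of "N p q"] N_pos[of p q] unfolding C_def by linarith+
  qed
  \<comment> \<open>With a nonpositive rate the left side is largest at the start of the interval,
    otherwise it is bounded by its value at the end, where \<open>gain\<close> applies.\<close>
  have growth: "c (m k) * exp (r (m k) * (s - t k)) \<le> C" if s: "s \<in> {t k..<t (Suc k)}" for k s
  proof (cases "r (m k) \<le> 0")
    case True
    then have "exp (r (m k) * (s - t k)) \<le> 1" using s by (simp add: mult_nonpos_nonneg)
    then have "c (m k) * exp (r (m k) * (s - t k)) \<le> c (m k) * 1"
      using c_pos[of "m k"] by (intro mult_left_mono) auto
    then show ?thesis using C_c[of "m k"] by simp
  next
    case False
    have "c (m k) * exp (r (m k) * (s - t k)) \<le> c (m k) * exp (r (m k) * (t (Suc k) - t k))"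
      using c_pos[of "m k"] s False by (intro mult_left_mono) auto
    also have "\<dots> \<le> 1 / N (m k) (m (Suc k))"
      using gain[of k] N_pos[of "m k" "m (Suc k)"] by (simp add: field_simps)
    finally show ?thesis using C_N[of "m k" "m (Suc k)"] by simp
  qed
  \<comment> \<open>Leaving the coordinates of the current mode costs a factor
    \<open>spectral_norm (P p)\<close>; the finite sum bounds it for every mode.\<close>
  define B where "B = (\<Sum>p\<in>UNIV. spectral_norm (P p))"
  have B: "spectral_norm (P p) \<le> B" for p
    unfolding B_def by (rule member_le_sum) (auto intro: spectral_norm_nonneg)
  have B0: "B \<ge> 0" unfolding B_def by (intro sum_nonneg spectral_norm_nonneg)
  define D where "D = spectral_norm (matrix_inv (P (m 0)))"
  have D0: "D \<ge> 0" unfolding D_def by (rule spectral_norm_nonneg)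

  \<comment> \<open>The constants depend on neither \<open>x\<close> nor \<open>s\<close>;
    \<open>D\<close> is the cost of entering the coordinates of the initial mode.\<close>
  have main: "norm (x s) \<le> B * C * D * norm (x 0)"
    if x: "reset_solution A R \<sigma> x" and s: "s \<ge> 0" for x s
  proof -
    define V where "V k = norm (matrix_inv (P (m k)) *v cvec (x (t k)))" for k
    have ode: "(x has_vector_derivative (A (m k) *v x u)) (at u within {t k..<t (Suc k)})"
      if u: "u \<in> {t k..<t (Suc k)}" for k u
    proof -
      have "\<forall>s\<in>{t k..<t (Suc k)}. (x has_vector_derivative (A (\<sigma> s) *v x s)) (at s within {t k..<t (Suc k)})"
        using x unfolding reset_solution_def t_def[symmetric] by (auto dest!: spec[of _ "Suc k"])
      from bspec[OF this u] show ?thesis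
        by (simp add: switching_signal_constant[OF t u] m_def)
    qed
    have reset: "\<exists>l. (x \<longlongrightarrow> l) (at_left (t (Suc k))) \<and> x (t (Suc k)) = R (m k, m (Suc k)) *v l" for k
      using x unfolding reset_solution_def m_def t_def[symmetric]
      by (auto dest!: spec[of _ "Suc k"])
    have flow: "norm (matrix_inv (P (m k)) *v cvec (x u))
        \<le> c (m k) * exp (r (m k) * (u - t k)) * V k" if "u \<in> {t k<..<t (Suc k)}" for k u
      unfolding V_def by (rule mode_norm_le[OF inv dec ode bound that])
    have V_Suc: "V (Suc k) \<le> V k" for k
    proof -
      obtain l where l: "(x \<longlongrightarrow> l) (at_left (t (Suc k)))"
        "x (t (Suc k)) = R (m k, m (Suc k)) *v l"
        using reset by blast
      have "V (Suc k) \<le> N (m k) (m (Suc k)) * (c (m k) * exp (r (m k) * (t (Suc k) - t k)) * V k)"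
        unfolding V_def[of "Suc k"] l(2) N_def by (rule reset_norm_le[OF inv t_less flow l(1)])
      also have "\<dots> \<le> 1 * V k"
        using mult_right_mono[OF gain[of k], of "V k"] by (simp add: V_def mult_ac)
      finally show ?thesis by simp
    qed
    have V_le: "V k \<le> D * norm (x 0)" for k
    proof -
      have "V k \<le> V 0" using lift_Suc_antimono_le[of V 0 k] V_Suc by simp
      also have "\<dots> \<le> D * norm (x 0)"
        using norm_matrix_vector_le[of "matrix_inv (P (m 0))" "cvec (x 0)"]
        by (simp add: V_def D_def t0)
      finally show ?thesis .
    qed
    obtain k where k: "s \<in> {t k..<t (Suc k)}" using switching_sequence_interval[OF t s] .
    let ?z = "matrix_inv (P (m k)) *v cvec (x s)"
    have "norm ?z \<le> C * V k"
    \<comment> \<open>At the switching time itself \<open>flow\<close> says nothing, and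
      \<open>1 \<le> C\<close> is enough.\<close>
    proof (cases "s = t k")
      case True
      then show ?thesis using mult_right_mono[OF C_1, of "V k"] by (simp add: V_def)
    next
      case False
      then have "norm ?z \<le> c (m k) * exp (r (m k) * (s - t k)) * V k"
        using k by (intro flow) auto
      also have "\<dots> \<le> C * V k"
        using growth[OF k] by (intro mult_right_mono) (auto simp: V_def)
      finally show ?thesis .
    qed
    also have "\<dots> \<le> C * (D * norm (x 0))" using V_le C_1 by (intro mult_left_mono) auto
    finally have z: "norm ?z \<le> C * (D * norm (x 0))" .
    have "cvec (x s) = P (m k) *v ?z"
      using inv by (simp add: matrix_vector_mul_assoc matrix_inv_right)
    then have "norm (x s) \<le> spectral_norm (P (m k)) * norm ?z"
      using norm_matrix_vector_le[of "P (m k)" ?z] norm_cvec[of "x s"] by simp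
    also have "\<dots> \<le> B * (C * (D * norm (x 0)))"
      using B B0 z by (intro mult_mono) auto
    finally show ?thesis by (simp add: mult_ac)
  qed
  show "reset_system_stable A R \<sigma>"
    unfolding reset_system_stable_def
  proof (intro allI impI)
    fix \<epsilon> :: real assume \<epsilon>: "\<epsilon> > 0"
    \<comment> \<open>The summand 1 makes the divisor positive from nonnegativity of the product
      alone.\<close>
    let ?L = "B * C * D + 1"
    have L: "?L > 0" using B0 C_1 D0 by (simp add: add_nonneg_pos)
    show "\<exists>\<delta>>0. \<forall>x. reset_solution A R \<sigma> x \<longrightarrow> norm (x 0) < \<delta> \<longrightarrow> (\<forall>t>0. norm (x t) < \<epsilon>)"
    proof (intro exI[of _ "\<epsilon> / ?L"] conjI allI impI)
      fix x s assume x: "reset_solution A R \<sigma> x" "norm (x 0) < \<epsilon> / ?L" and s: "(s::real) > 0"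
      have "norm (x s) \<le> B * C * D * norm (x 0)" using main x s by simp
      also have "\<dots> \<le> ?L * norm (x 0)" by (intro mult_right_mono) auto
      also have "\<dots> < \<epsilon>" using x(2) L by (simp add: field_simps)
      finally show "norm (x s) < \<epsilon>" .
    qed (use \<epsilon> L in simp)
  qed
qed

end
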